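(* Let $E$ be a compact Polish space, $\alpha$ a probability measure on $E$, $\Phi:E\times E\to\mathbb{R}$ a bounded measurable function, and $W$ a random variable with values in $(0,\infty)$, law $P$ and $\mathbb{E}[W^2]<\infty$. If $$\mathbb{E}^{sb}(W)\cdot\frac12\,\delta^{(2)}(e^{\Phi})<1,$$ then there is a unique solution $V$ to the fixed point equation $$V(\sigma)=\int P^{sb}(dw)\,\frac{\int\alpha(d\tilde\sigma)\,e^{\Phi(\sigma,\tilde\sigma)}e^{wV(\tilde\sigma)}}{\int\alpha(d\tilde\sigma)\,e^{wV(\tilde\sigma)}}\qquad(\sigma\in E)$$ (and hence there is absence of phase transition in the annealed spin model on generalized random graphs, in the sense that this mean-field equation has exactly one solution).
   Context: $P^{sb}(dw)=\frac{w}{\mathbb{E}[W]}P(dw)$ is the size-biased law and $\mathbb{E}^{sb}(W)=\int P^{sb}(dw)\,w=\mathbb{E}[W^2]/\mathbb{E}[W]$. The second order variation of $f:E\times E\to\mathbb{R}$ is $$\delta^{(2)}(f)=\sup_{\sigma_1,\sigma_2,\sigma_3,\sigma_4\in E}\bigl(f(\sigma_1,\sigma_3)-f(\sigma_2,\sigma_3)-f(\sigma_1,\sigma_4)+f(\sigma_2,\sigma_4)\bigr).$$ Solutions $V$ are sought among bounded measurable functions $E\to\mathbb{R}$. *)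

theory Defs
  imports "HOL-Probability.Probability"
begin

text \<open>The measure \<open>P\<close> is the law of a nonnegative random variable \<open>W\<close>, so the density
  below is \<open>w / E[W]\<close>. It is a probability density when \<open>0 < E[W] < \<infinity>\<close>.\<close>

definition size_biased :: "real measure \<Rightarrow> real measure" where
  "size_biased P = density P (\<lambda>w. ennreal (w / (\<integral>x. x \<partial>P)))"

definition size_biased_mean :: "real measure \<Rightarrow> real" where
  "size_biased_mean P = (\<integral>w. w \<partial>size_biased P)"

lemma size_biased_mean_eq:
  assumes [measurable_cong]: "sets P = sets borel" and pos: "AE w in P. 0 \<le> w"
  shows "size_biased_mean P = (\<integral>w. w\<^sup>2 \<partial>P) / (\<integral>w. w \<partial>P)"
proof -
  have nn: "0 \<le> (\<integral>x. x \<partial>P)"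
    using pos by (rule integral_nonneg_AE)
  have "(\<integral>w. w \<partial>density P (\<lambda>w. ennreal (w / (\<integral>x. x \<partial>P)))) =
      (\<integral>w. (w / (\<integral>x. x \<partial>P)) *\<^sub>R w \<partial>P)"
    by (rule integral_density) (use pos nn in \<open>auto elim!: eventually_mono\<close>)
  then show ?thesis
    by (simp add: size_biased_mean_def size_biased_def power2_eq_square)
qed

text \<open>The supremum is taken over the reals; it is the intended finite one whenever \<open>f\<close> is
  bounded, as for \<open>f = exp \<circ> \<Phi>\<close> with \<open>\<Phi>\<close> bounded.\<close>

definition second_order_variation :: "('a \<times> 'a \<Rightarrow> real) \<Rightarrow> real" where
  "second_order_variation f =
     (SUP (s1, s2, s3, s4) \<in> UNIV. f (s1, s3) - f (s2, s3) - f (s1, s4) + f (s2, s4))"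

lemma bdd_above_second_order_variation:
  assumes "bounded (range f)"
  shows "bdd_above ((\<lambda>(s1, s2, s3, s4).
    f (s1, s3) - f (s2, s3) - f (s1, s4) + f (s2, s4) :: real) ` UNIV)"
proof -
  obtain B where "\<And>p. \<bar>f p\<bar> \<le> B"
    using assms by (auto simp: bounded_iff)
  then have "f (s1, s3) - f (s2, s3) - f (s1, s4) + f (s2, s4) \<le> 4 * B" for s1 s2 s3 s4
    by (smt (verit))
  then show ?thesis
    by (intro bdd_aboveI[of _ "4 * B"]) auto
qed

definition mean_field_operator ::
  "'a measure \<Rightarrow> ('a \<times> 'a \<Rightarrow> real) \<Rightarrow> real measure \<Rightarrow> ('a \<Rightarrow> real) \<Rightarrow> 'a \<Rightarrow> real" where
  "mean_field_operator \<alpha> \<Phi> P V \<sigma> =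
     (\<integral>w. (\<integral>\<tau>. exp (\<Phi> (\<sigma>, \<tau>)) * exp (w * V \<tau>) \<partial>\<alpha>) / (\<integral>\<tau>. exp (w * V \<tau>) \<partial>\<alpha>)
        \<partial>size_biased P)"

definition mean_field_solution ::
  "'a::topological_space measure \<Rightarrow> ('a \<times> 'a \<Rightarrow> real) \<Rightarrow> real measure \<Rightarrow> ('a \<Rightarrow> real) \<Rightarrow> bool" where
  "mean_field_solution \<alpha> \<Phi> P V \<longleftrightarrow>
     V \<in> borel_measurable borel \<and> bounded (range V) \<and>
     (\<forall>\<sigma>. V \<sigma> = mean_field_operator \<alpha> \<Phi> P V \<sigma>)"

end

theory Submission
  imports Defs
begin

text \<open>The Gibbs measures with weights \<open>exp (w * V1)\<close> and \<open>exp (w * V2)\<close> do not change when a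
  constant is added to \<open>V1\<close> or \<open>V2\<close>, so \<open>\<bar>V1 - V2 - c\<bar> \<le> e\<close> may be read as \<open>\<bar>V1 - V2\<bar> \<le> e\<close>. Then the
  normalized density of the measure with the smaller partition function is at least
  \<open>exp (- w * e) \<ge> 1 - w * e\<close> times the other one, and the means of any function of oscillation
  \<open>D\<close> differ by at most \<open>w * e * D\<close>. Applied to \<open>\<tau> \<mapsto> exp (\<Phi> (\<sigma>1, \<tau>)) - exp (\<Phi> (\<sigma>2, \<tau>))\<close> and
  integrated over \<open>w\<close>, this shows that the mean-field operator contracts the distance of functions
  modulo constants. The sup norm of the image is in turn controlled by this distance, so the Picard
  iterates converge uniformly.\<close>

section \<open>Means of a function under two comparable weights\<close>

lemma bounded_range_abs_leE:
  fixes f :: "'a \<Rightarrow> real"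
  assumes "bounded (range f)"
  obtains B where "\<And>x. \<bar>f x\<bar> \<le> B"
  using assms by (auto simp: bounded_iff)

lemma weighted_mean_bounds:
  fixes g u :: "'a \<Rightarrow> real"
  assumes "integrable M u" "integrable M (\<lambda>x. g x * u x)"
    and "\<And>x. 0 \<le> u x" "\<And>x. a \<le> g x" "\<And>x. g x \<le> b"
  shows "a * (\<integral>x. u x \<partial>M) \<le> (\<integral>x. g x * u x \<partial>M)" "(\<integral>x. g x * u x \<partial>M) \<le> b * (\<integral>x. u x \<partial>M)"
proof -
  have "(\<integral>x. a * u x \<partial>M) \<le> (\<integral>x. g x * u x \<partial>M)" "(\<integral>x. g x * u x \<partial>M) \<le> (\<integral>x. b * u x \<partial>M)"
    using assms by (intro integral_mono; simp add: mult_right_mono)+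
  then show "a * (\<integral>x. u x \<partial>M) \<le> (\<integral>x. g x * u x \<partial>M)" "(\<integral>x. g x * u x \<partial>M) \<le> b * (\<integral>x. u x \<partial>M)"
    by simp_all
qed

text \<open>Because \<open>v\<close> has the smaller total mass, normalizing both weights preserves
  \<open>(1 - d) * u x \<le> v x\<close>. Without this ordering the ratio of the total masses would
  enter as a second factor, roughly doubling \<open>d\<close>, and the 1/2 in the final condition
  would be lost.\<close>

lemma weighted_mean_diff_le_aux:
  fixes g u v :: "'a \<Rightarrow> real"
  assumes int: "integrable M u" "integrable M v"
    "integrable M (\<lambda>x. g x * u x)" "integrable M (\<lambda>x. g x * v x)"
    and nonneg: "\<And>x. 0 \<le> u x" "\<And>x. 0 \<le> v x"
    and Z: "0 < (\<integral>x. v x \<partial>M)" "(\<integral>x. v x \<partial>M) \<le> (\<integral>x. u x \<partial>M)"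
    and d: "0 \<le> d" "\<And>x. (1 - d) * u x \<le> v x"
    and g: "\<And>x. a \<le> g x" "\<And>x. g x \<le> b"
  shows "\<bar>(\<integral>x. g x * u x \<partial>M) / (\<integral>x. u x \<partial>M) - (\<integral>x. g x * v x \<partial>M) / (\<integral>x. v x \<partial>M)\<bar> \<le> d * (b - a)"
proof -
  define Zu Zv where "Zu = (\<integral>x. u x \<partial>M)" and "Zv = (\<integral>x. v x \<partial>M)"
  have pos: "0 < Zv" "Zv \<le> Zu" "0 < Zu"
    using Z by (auto simp: Zu_def Zv_def)
  \<comment> \<open>\<open>q\<close> is what remains of the normalized \<open>v\<close> once a
    fraction \<open>1 - d\<close> of the normalized \<open>u\<close> is removed: nonnegative and of
    total mass \<open>d\<close>.\<close>
  define q where "q x = v x / Zv - (1 - d) * (u x / Zu)" for x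
  have q: "0 \<le> q x" for x
  proof -
    have "(1 - d) * (u x / Zu) \<le> v x / Zu"
      using d(2)[of x] pos by (simp add: divide_right_mono)
    also have "\<dots> \<le> v x / Zv"
      using pos nonneg(2)[of x] by (simp add: frac_le)
    finally show ?thesis by (simp add: q_def)
  qed
  have gq: "g x * q x = g x * v x / Zv - (1 - d) * (g x * u x / Zu)" for x
    by (simp add: q_def algebra_simps)
  have iq: "integrable M q" "integrable M (\<lambda>x. g x * q x)"
    unfolding gq using int by (auto simp: q_def[abs_def])
  have "(\<integral>x. q x \<partial>M) = Zv / Zv - (1 - d) * (Zu / Zu)"
    using int by (simp add: q_def Zu_def Zv_def)
  then have "(\<integral>x. q x \<partial>M) = d"
    using pos by simp
  then have 1: "a * d \<le> (\<integral>x. g x * q x \<partial>M)" "(\<integral>x. g x * q x \<partial>M) \<le> b * d"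
    using weighted_mean_bounds[of M q g a b] iq q g by auto
  define X where "X = (\<integral>x. g x * u x \<partial>M) / Zu"
  have "a \<le> X" "X \<le> b"
    using weighted_mean_bounds[of M u g a b] int nonneg g pos
    by (auto simp: field_simps Zu_def X_def)
  then have 2: "d * a \<le> d * X" "d * X \<le> d * b"
    using d(1) by (blast intro: mult_left_mono)+
  \<comment> \<open>So the two means differ by \<open>d * X\<close> minus the integral of
    \<open>g x * q x\<close>, and both of these lie between \<open>a * d\<close> and
    \<open>b * d\<close>.\<close>
  have "(\<integral>x. g x * q x \<partial>M) = (\<integral>x. g x * v x \<partial>M) / Zv - (1 - d) * X"
    unfolding gq X_def using int by simp
  then show ?thesis
    using 1 2 unfolding Zu_def[symmetric] Zv_def[symmetric] X_def[symmetric]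
      abs_le_iff right_diff_distrib left_diff_distrib by (simp add: mult.commute)
qed

text \<open>The pointwise comparison is assumed in both directions since either weight may have the
  smaller integral; the case distinction picks the direction that applies.\<close>

lemma weighted_mean_diff_le:
  fixes g u v :: "'a \<Rightarrow> real"
  assumes int: "integrable M u" "integrable M v"
    "integrable M (\<lambda>x. g x * u x)" "integrable M (\<lambda>x. g x * v x)"
    and nonneg: "\<And>x. 0 \<le> u x" "\<And>x. 0 \<le> v x"
    and Z: "0 < (\<integral>x. u x \<partial>M)" "0 < (\<integral>x. v x \<partial>M)"
    and d: "0 \<le> d" "\<And>x. (1 - d) * u x \<le> v x" "\<And>x. (1 - d) * v x \<le> u x"
    and D: "\<And>x y. g x - g y \<le> D"
  shows "\<bar>(\<integral>x. g x * u x \<partial>M) / (\<integral>x. u x \<partial>M) - (\<integral>x. g x * v x \<partial>M) / (\<integral>x. v x \<partial>M)\<bar> \<le> d * D"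
proof -
  \<comment> \<open>Any two values of \<open>g\<close> differ by at most \<open>D\<close>, so both
    extremes are finite and \<open>b - a \<le> D\<close>.\<close>
  define a b where "a = (INF x. g x)" and "b = (SUP x. g x)"
  have upper: "g x \<le> D + g y" for x y
    using D[of x y] by simp
  have lower: "g x - D \<le> g y" for x y
    using D[of x y] by simp
  have "bdd_above (range g)" "bdd_below (range g)"
    by (rule bdd_aboveI2[OF upper], rule bdd_belowI2[OF lower])
  then have g: "a \<le> g x" "g x \<le> b" for x
    by (auto simp: a_def b_def intro: cINF_lower cSUP_upper)
  have "b - D \<le> g y" for y
  proof -
    have "b \<le> D + g y"
      unfolding b_def by (intro cSUP_least upper) auto
    then show ?thesis by simp
  qed
  then have "b - D \<le> a"
    unfolding a_def by (intro cINF_greatest) auto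
  then have ab: "d * (b - a) \<le> d * D"
    using d(1) by (intro mult_left_mono) auto
  show ?thesis
  proof (cases "(\<integral>x. v x \<partial>M) \<le> (\<integral>x. u x \<partial>M)")
    case True
    show ?thesis
      using weighted_mean_diff_le_aux[OF int nonneg Z(2) True d(1,2) g] ab by simp
  next
    case False
    then have "(\<integral>x. u x \<partial>M) \<le> (\<integral>x. v x \<partial>M)" by simp
    from weighted_mean_diff_le_aux[OF int(2,1,4,3) nonneg(2,1) Z(1) this d(1,3) g]
    show ?thesis
      using ab by (simp add: abs_minus_commute)
  qed
qed

section \<open>Gibbs means of bounded functions\<close>

definition gibbs_mean :: "'a measure \<Rightarrow> ('a \<Rightarrow> real) \<Rightarrow> ('a \<Rightarrow> real) \<Rightarrow> real" where
  "gibbs_mean M f g = (\<integral>x. g x * exp (f x) \<partial>M) / (\<integral>x. exp (f x) \<partial>M)"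

lemma gibbs_mean_add_const: "gibbs_mean M (\<lambda>x. f x + c) g = gibbs_mean M f g"
  by (simp add: gibbs_mean_def exp_add mult.assoc[symmetric])

context prob_space
begin

lemma integrable_exp_bounded:
  fixes f :: "'a \<Rightarrow> real"
  assumes [measurable]: "f \<in> borel_measurable M" and "bounded (range f)"
  shows "integrable M (\<lambda>x. exp (f x))"
proof -
  obtain B where "\<And>x. \<bar>f x\<bar> \<le> B"
    using assms(2) by (rule bounded_range_abs_leE) blast
  then have "\<And>x. f x \<le> B"
    by (simp add: abs_le_iff)
  then show ?thesis
    by (intro integrable_const_bound[where B = "exp B"]) auto
qed

lemma integrable_mult_exp_bounded:
  fixes f g :: "'a \<Rightarrow> real"
  assumes "f \<in> borel_measurable M" "bounded (range f)"
    and "g \<in> borel_measurable M" "bounded (range g)"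
  shows "integrable M (\<lambda>x. g x * exp (f x))"
proof -
  obtain B where B: "\<And>x. \<bar>g x\<bar> \<le> B"
    using assms(4) by (rule bounded_range_abs_leE) blast
  have [measurable]: "f \<in> borel_measurable M" "g \<in> borel_measurable M"
    by (rule assms)+
  have bound: "\<bar>g x * exp (f x)\<bar> \<le> \<bar>B * exp (f x)\<bar>" for x
    using B[of x] by (simp add: abs_mult)
  have "integrable M (\<lambda>x. B * exp (f x))"
    using integrable_exp_bounded[OF assms(1,2)] by simp
  then show ?thesis
    by (rule Bochner_Integration.integrable_bound) (simp_all only: real_norm_def bound, simp_all)
qed

lemma integral_exp_pos:
  fixes f :: "'a \<Rightarrow> real"
  assumes "f \<in> borel_measurable M" "bounded (range f)"
  shows "0 < (\<integral>x. exp (f x) \<partial>M)"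
proof -
  have "expectation (\<lambda>x. 0) < expectation (\<lambda>x. exp (f x))"
    using integrable_exp_bounded[OF assms] emeasure_space_1
    by (intro integral_less_AE_space) auto
  then show ?thesis by simp
qed

lemma gibbs_mean_abs_le:
  fixes f g :: "'a \<Rightarrow> real"
  assumes f: "f \<in> borel_measurable M" "bounded (range f)"
    and g: "g \<in> borel_measurable M" "\<And>x. \<bar>g x\<bar> \<le> B"
  shows "\<bar>gibbs_mean M f g\<bar> \<le> B"
proof -
  have "bounded (range g)"
    using g(2) by (auto simp: bounded_iff)
  then have int: "integrable M (\<lambda>x. g x * exp (f x))"
    by (rule integrable_mult_exp_bounded[OF f g(1)])
  have "- B \<le> g x" "g x \<le> B" for x
    using g(2)[of x] by (auto simp: abs_le_iff)
  note weighted_mean_bounds[OF integrable_exp_bounded[OF f] int exp_ge_zero this]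
  then show ?thesis
    using integral_exp_pos[OF f]
    by (simp add: gibbs_mean_def abs_le_iff pos_divide_le_eq minus_le_iff pos_le_divide_eq)
qed

lemma gibbs_mean_diff:
  fixes f g h :: "'a \<Rightarrow> real"
  assumes "f \<in> borel_measurable M" "bounded (range f)"
    and "g \<in> borel_measurable M" "bounded (range g)"
    and "h \<in> borel_measurable M" "bounded (range h)"
  shows "gibbs_mean M f (\<lambda>x. g x - h x) = gibbs_mean M f g - gibbs_mean M f h"
  using assms by (simp add: gibbs_mean_def left_diff_distrib diff_divide_distrib
      integrable_mult_exp_bounded)

text \<open>The free constant \<open>c\<close> lets \<open>d\<close> be half the oscillation of
  \<open>f1 - f2\<close>, whereas \<open>D\<close> bounds the full oscillation of \<open>g\<close>;
  this asymmetry is the source of the factor 1/2 in \<open>rate\<close>.\<close>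

lemma gibbs_mean_diff_le:
  fixes f1 f2 g :: "'a \<Rightarrow> real"
  assumes f1: "f1 \<in> borel_measurable M" "bounded (range f1)"
    and f2: "f2 \<in> borel_measurable M" "bounded (range f2)"
    and g: "g \<in> borel_measurable M" "bounded (range g)"
    and d: "\<And>x. \<bar>f1 x - f2 x - c\<bar> \<le> d"
    and D: "\<And>x y. g x - g y \<le> D"
  shows "\<bar>gibbs_mean M f1 g - gibbs_mean M f2 g\<bar> \<le> d * D"
proof -
  define h where "h x = f2 x + c" for x
  obtain B where B: "\<And>x. \<bar>f2 x\<bar> \<le> B"
    using f2(2) by (rule bounded_range_abs_leE) blast
  have "\<bar>h x\<bar> \<le> B + \<bar>c\<bar>" for x
    using B[of x] by (simp add: h_def)
  then have "bounded (range h)"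
    by (auto simp: bounded_iff)
  moreover have "h \<in> borel_measurable M"
    unfolding h_def using f2(1) by measurable
  ultimately have h: "h \<in> borel_measurable M" "bounded (range h)" by auto
  have d0: "0 \<le> d"
    using d[of undefined] by simp
  have key: "(1 - d) * exp s \<le> exp t" if "\<bar>s - t\<bar> \<le> d" for s t :: real
  proof -
    have "1 - d \<le> exp (- d)"
      using exp_ge_add_one_self[of "- d"] by simp
    also have "\<dots> \<le> exp (t - s)"
      using that by simp
    finally show ?thesis
      by (simp add: exp_diff field_simps)
  qed
  have fh: "\<bar>f1 x - h x\<bar> \<le> d" "\<bar>h x - f1 x\<bar> \<le> d" for x
    using d[of x] by (auto simp: h_def)
  have "\<bar>gibbs_mean M f1 g - gibbs_mean M h g\<bar> \<le> d * D"
    unfolding gibbs_mean_def using f1 h g d0 D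
    by (intro weighted_mean_diff_le key fh integrable_exp_bounded integrable_mult_exp_bounded
        integral_exp_pos) auto
  then show ?thesis
    by (simp add: h_def[abs_def] gibbs_mean_add_const)
qed

end

section \<open>Oscillation distance\<close>

text \<open>Distance modulo constants: half of the oscillation of \<open>V1 - V2\<close> is at most \<open>e\<close>.\<close>

definition near_mod_const :: "real \<Rightarrow> ('a \<Rightarrow> real) \<Rightarrow> ('a \<Rightarrow> real) \<Rightarrow> bool" where
  "near_mod_const e V1 V2 \<longleftrightarrow> (\<exists>c. \<forall>x. \<bar>V1 x - V2 x - c\<bar> \<le> e)"

lemma near_mod_constI:
  fixes V1 V2 :: "'a \<Rightarrow> real"
  assumes "\<And>x y. (V1 x - V2 x) - (V1 y - V2 y) \<le> 2 * e"
  shows "near_mod_const e V1 V2"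
proof -
  define g where "g x = V1 x - V2 x" for x
  have g: "g x \<le> 2 * e + g y" for x y
    using assms[of x y] by (simp add: g_def)
  have bdd: "bdd_above (range g)"
    using g[of _ undefined] by (rule bdd_aboveI2)
  have upper: "g x \<le> (SUP x. g x)" for x
    using bdd by (intro cSUP_upper) auto
  have lower: "(SUP x. g x) \<le> 2 * e + g y" for y
    using g by (intro cSUP_least) auto
  \<comment> \<open>All values of \<open>g\<close> lie in the interval of length
    \<open>2 * e\<close> below the supremum; its midpoint is the witness for the constant.\<close>
  have "\<bar>g x - ((SUP x. g x) - e)\<bar> \<le> e" for x
    using upper[of x] lower[of x] by (simp add: abs_le_iff)
  then show ?thesis
    by (auto simp: near_mod_const_def g_def)
qed

section \<open>The mean-field operator and its contraction estimates\<close>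

text \<open>The conditions on \<open>P\<close> are stated through its size-biased law, the measure
  integrated against in the operator. \<open>mean_field_distr\<close> derives them from a positive
  random variable with finite second moment.\<close>

locale mean_field =
  fixes \<alpha> :: "'a::polish_space measure" and \<Phi> :: "'a \<times> 'a \<Rightarrow> real" and P :: "real measure"
  assumes prob_alpha: "prob_space \<alpha>" and sets_alpha [measurable_cong]: "sets \<alpha> = sets borel"
    and Phi_measurable: "\<Phi> \<in> borel_measurable borel" and Phi_bounded: "bounded (range \<Phi>)"
    and prob_size_biased: "prob_space (size_biased P)"
    and sets_size_biased [measurable_cong]: "sets (size_biased P) = sets borel"
    and size_biased_nonneg: "AE w in size_biased P. 0 \<le> w"
    and integrable_size_biased: "integrable (size_biased P) (\<lambda>w. w)"
begin

sublocale alpha: prob_space \<alpha> by (rule prob_alpha)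
sublocale sb: prob_space "size_biased P" by (rule prob_size_biased)

abbreviation F :: "'a \<Rightarrow> 'a \<Rightarrow> real" where "F \<sigma> \<tau> \<equiv> exp (\<Phi> (\<sigma>, \<tau>))"
abbreviation T :: "('a \<Rightarrow> real) \<Rightarrow> 'a \<Rightarrow> real" where "T \<equiv> mean_field_operator \<alpha> \<Phi> P"
abbreviation admissible :: "('a \<Rightarrow> real) \<Rightarrow> bool" where
  "admissible V \<equiv> V \<in> borel_measurable borel \<and> bounded (range V)"
abbreviation rate :: real where
  "rate \<equiv> size_biased_mean P * (1 / 2 * second_order_variation (\<lambda>p. exp (\<Phi> p)))"

text \<open>By second countability the Borel sets of the product form the product sigma-algebra, the
  form needed for measurability of parameter integrals.\<close>

lemma Phi_measurable_pair [measurable]: "\<Phi> \<in> borel_measurable (borel \<Otimes>\<^sub>M borel)"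
  using Phi_measurable by (simp add: borel_prod)

lemma F_boundE:
  obtains B where "0 \<le> B" "\<And>\<sigma> \<tau>. \<bar>F \<sigma> \<tau>\<bar> \<le> B"
proof -
  obtain B where B: "\<And>p. \<bar>\<Phi> p\<bar> \<le> B"
    using Phi_bounded by (rule bounded_range_abs_leE) blast
  then have "\<Phi> p \<le> B" for p
    using B[of p] by (simp add: abs_le_iff)
  then show ?thesis
    by (intro that[of "exp B"]) auto
qed

lemma F_admissible: "F \<sigma> \<in> borel_measurable \<alpha>" "bounded (range (F \<sigma>))"
proof -
  show "F \<sigma> \<in> borel_measurable \<alpha>" by measurable
  show "bounded (range (F \<sigma>))"
    by (rule F_boundE) (auto simp: bounded_iff)
qed

lemma scaled_admissible:
  assumes "admissible V"
  shows "(\<lambda>\<tau>. w * V \<tau>) \<in> borel_measurable \<alpha>" "bounded (range (\<lambda>\<tau>. w * V \<tau>))"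
proof -
  have [measurable]: "V \<in> borel_measurable borel" using assms by simp
  show "(\<lambda>\<tau>. w * V \<tau>) \<in> borel_measurable \<alpha>" by measurable
  have "range (\<lambda>\<tau>. w * V \<tau>) = (\<lambda>x. w *\<^sub>R x) ` range V" by auto
  with assms bounded_scaling[of "range V" w] show "bounded (range (\<lambda>\<tau>. w * V \<tau>))" by simp
qed

lemma T_eq: "T V \<sigma> = (\<integral>w. gibbs_mean \<alpha> (\<lambda>\<tau>. w * V \<tau>) (F \<sigma>) \<partial>size_biased P)"
  by (simp add: mean_field_operator_def gibbs_mean_def)

text \<open>Joint measurability serves twice: sections in w give integrability for fixed \<sigma>,
  and integrating out w gives measurability of \<open>T V\<close>.\<close>

lemma measurable_gibbs:
  assumes "admissible V"
  shows "(\<lambda>(\<sigma>, w). gibbs_mean \<alpha> (\<lambda>\<tau>. w * V \<tau>) (F \<sigma>)) \<in> borel_measurable (borel \<Otimes>\<^sub>M size_biased P)"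
proof -
  have [measurable]: "V \<in> borel_measurable borel" using assms by simp
  show ?thesis
    unfolding gibbs_mean_def by measurable
qed

lemma integrable_gibbs:
  assumes "admissible V"
  shows "integrable (size_biased P) (\<lambda>w. gibbs_mean \<alpha> (\<lambda>\<tau>. w * V \<tau>) (F \<sigma>))"
proof -
  obtain B where B: "\<And>\<sigma> \<tau>. \<bar>F \<sigma> \<tau>\<bar> \<le> B" by (rule F_boundE) blast
  have "(\<lambda>w. gibbs_mean \<alpha> (\<lambda>\<tau>. w * V \<tau>) (F \<sigma>)) \<in> borel_measurable (size_biased P)"
    using measurable_Pair2[OF measurable_gibbs[OF assms], of \<sigma>] by simp
  then show ?thesis
    using alpha.gibbs_mean_abs_le[OF scaled_admissible[OF assms] F_admissible(1) B]
    by (intro sb.integrable_const_bound[where B = B]) auto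
qed

lemma T_admissible:
  assumes "admissible V"
  shows "admissible (T V)"
proof
  show "T V \<in> borel_measurable borel"
    unfolding T_eq[abs_def] using measurable_gibbs[OF assms]
    by (rule sb.borel_measurable_lebesgue_integral)
  obtain B where B: "\<And>\<sigma> \<tau>. \<bar>F \<sigma> \<tau>\<bar> \<le> B" by (rule F_boundE) blast
  have "\<bar>T V \<sigma>\<bar> \<le> B" for \<sigma>
  proof -
    have "\<bar>T V \<sigma>\<bar> \<le> (\<integral>w. \<bar>gibbs_mean \<alpha> (\<lambda>\<tau>. w * V \<tau>) (F \<sigma>)\<bar> \<partial>size_biased P)"
      unfolding T_eq by (rule integral_abs_bound)
    also have "\<dots> \<le> (\<integral>w. B \<partial>size_biased P)"
      using integrable_gibbs[OF assms]
        alpha.gibbs_mean_abs_le[OF scaled_admissible[OF assms] F_admissible(1) B]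
      by (intro integral_mono) auto
    finally show ?thesis by (simp add: sb.prob_space)
  qed
  then show "bounded (range (T V))" by (auto simp: bounded_iff)
qed

lemma size_biased_mean_nonneg: "0 \<le> size_biased_mean P"
  unfolding size_biased_mean_def using size_biased_nonneg by (rule integral_nonneg_AE)

lemma second_order_variation_upper:
  "F s1 s3 - F s2 s3 - F s1 s4 + F s2 s4 \<le> second_order_variation (\<lambda>p. exp (\<Phi> p))"
proof -
  have "bounded (range (\<lambda>p. exp (\<Phi> p)))"
    by (rule F_boundE) (auto simp: bounded_iff)
  from cSUP_upper[OF _ bdd_above_second_order_variation[OF this], of "(s1, s2, s3, s4)"]
  show ?thesis by (simp add: second_order_variation_def)
qed

lemma rate_nonneg: "0 \<le> rate"
  \<comment> \<open>When all four points coincide the alternating sum is 0, so the variation is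
    nonnegative.\<close>
  using second_order_variation_upper[of undefined undefined undefined undefined]
    size_biased_mean_nonneg by simp

text \<open>Taking the difference over the two points first leaves a single function
  \<open>g\<close> averaged under the two Gibbs measures. The oscillation of such a \<open>g\<close>
  is bounded by the second order variation, which is how that quantity enters.\<close>

lemma T_osc_le:
  assumes V1: "admissible V1" and V2: "admissible V2"
    and near: "near_mod_const e V1 V2"
  shows "near_mod_const (rate * e) (T V1) (T V2)"
proof (rule near_mod_constI)
  fix \<sigma>1 \<sigma>2
  let ?D = "second_order_variation (\<lambda>p. exp (\<Phi> p))"
  let ?G = "\<lambda>V \<sigma> w. gibbs_mean \<alpha> (\<lambda>\<tau>. w * V \<tau>) (F \<sigma>)"
  obtain c where c: "\<And>x. \<bar>V1 x - V2 x - c\<bar> \<le> e"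
    using near by (auto simp: near_mod_const_def)
  define g where "g \<tau> = F \<sigma>1 \<tau> - F \<sigma>2 \<tau>" for \<tau>
  have g: "g \<in> borel_measurable \<alpha>" "bounded (range g)"
    unfolding g_def using F_admissible[of \<sigma>1] F_admissible[of \<sigma>2]
    by (auto intro!: bounded_minus_comp)
  have gD: "g x - g y \<le> ?D" for x y
    \<comment> \<open>The arguments follow the order of occurrence in that lemma: \<open>s1\<close>,
      \<open>s3\<close>, \<open>s2\<close>, \<open>s4\<close>.\<close>
    using second_order_variation_upper[of \<sigma>1 x \<sigma>2 y] by (simp add: g_def)
  have gibbs_g: "gibbs_mean \<alpha> (\<lambda>\<tau>. w * V \<tau>) g = ?G V \<sigma>1 w - ?G V \<sigma>2 w" if "admissible V" for w V
    unfolding g_def[abs_def]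
    by (intro alpha.gibbs_mean_diff scaled_admissible[OF that] F_admissible)
  have "(T V1 \<sigma>1 - T V2 \<sigma>1) - (T V1 \<sigma>2 - T V2 \<sigma>2)
      = (\<integral>w. (?G V1 \<sigma>1 w - ?G V1 \<sigma>2 w) - (?G V2 \<sigma>1 w - ?G V2 \<sigma>2 w) \<partial>size_biased P)"
    using integrable_gibbs[OF V1] integrable_gibbs[OF V2] by (simp add: T_eq)
  also have "\<dots> \<le> (\<integral>w. w * (e * ?D) \<partial>size_biased P)"
  proof (rule integral_mono_AE)
    show "AE w in size_biased P.
        (?G V1 \<sigma>1 w - ?G V1 \<sigma>2 w) - (?G V2 \<sigma>1 w - ?G V2 \<sigma>2 w) \<le> w * (e * ?D)"
      using size_biased_nonneg
    proof eventually_elim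
      case (elim w)
      \<comment> \<open>The shift \<open>w * c\<close> varies with w, which is harmless because each
        Gibbs mean ignores its own shift.\<close>
      have "\<bar>w * V1 x - w * V2 x - w * c\<bar> \<le> w * e" for x
        using mult_left_mono[OF c[of x] elim] elim
        by (simp add: abs_mult right_diff_distrib[symmetric])
      from alpha.gibbs_mean_diff_le[OF scaled_admissible[OF V1] scaled_admissible[OF V2] g this gD]
      show ?case
        by (simp add: gibbs_g V1 V2 mult.assoc)
    qed
  qed (use integrable_gibbs[OF V1] integrable_gibbs[OF V2] integrable_size_biased in auto)
  \<comment> \<open>The factor 2 undoes the 1/2 in \<open>rate\<close>: the estimate is for the full
    oscillation, while \<open>near_mod_const\<close> measures half of it.\<close>
  also have "\<dots> = 2 * (rate * e)"
    by (simp add: size_biased_mean_def)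
  finally show "(T V1 \<sigma>1 - T V2 \<sigma>1) - (T V1 \<sigma>2 - T V2 \<sigma>2) \<le> 2 * (rate * e)" .
qed

text \<open>\<open>T\<close> sends functions that differ by a constant to the same image, so
  closeness modulo constants before \<open>T\<close> gives genuine uniform closeness after it. The
  factor \<open>K\<close> may be large; it is applied once, after the contraction has been
  iterated.\<close>

lemma T_sup_leE:
  obtains K where "0 \<le> K"
    "\<And>V1 V2 e \<sigma>. admissible V1 \<Longrightarrow> admissible V2 \<Longrightarrow> near_mod_const e V1 V2 \<Longrightarrow>
      \<bar>T V1 \<sigma> - T V2 \<sigma>\<bar> \<le> K * e"
proof -
  obtain B where B: "0 \<le> B" "\<And>\<sigma> \<tau>. \<bar>F \<sigma> \<tau>\<bar> \<le> B" by (rule F_boundE) blast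
  let ?G = "\<lambda>V \<sigma> w. gibbs_mean \<alpha> (\<lambda>\<tau>. w * V \<tau>) (F \<sigma>)"
  have FD: "F \<sigma> x - F \<sigma> y \<le> 2 * B" for \<sigma> x y
    using B(2)[of \<sigma> x] B(2)[of \<sigma> y] unfolding abs_le_iff by linarith
  have "\<bar>T V1 \<sigma> - T V2 \<sigma>\<bar> \<le> size_biased_mean P * (2 * B) * e"
    if V1: "admissible V1" and V2: "admissible V2" and near: "near_mod_const e V1 V2"
    for V1 V2 e \<sigma>
  proof -
    obtain c where c: "\<And>x. \<bar>V1 x - V2 x - c\<bar> \<le> e"
      using near by (auto simp: near_mod_const_def)
    have "T V1 \<sigma> - T V2 \<sigma> = (\<integral>w. ?G V1 \<sigma> w - ?G V2 \<sigma> w \<partial>size_biased P)"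
      using integrable_gibbs[OF V1] integrable_gibbs[OF V2] by (simp add: T_eq)
    also have "\<bar>\<dots>\<bar> \<le> (\<integral>w. \<bar>?G V1 \<sigma> w - ?G V2 \<sigma> w\<bar> \<partial>size_biased P)"
      by (rule integral_abs_bound)
    also have "\<dots> \<le> (\<integral>w. w * (e * (2 * B)) \<partial>size_biased P)"
    proof (rule integral_mono_AE)
      show "AE w in size_biased P. \<bar>?G V1 \<sigma> w - ?G V2 \<sigma> w\<bar> \<le> w * (e * (2 * B))"
        using size_biased_nonneg
      proof eventually_elim
        case (elim w)
        have "\<bar>w * V1 x - w * V2 x - w * c\<bar> \<le> w * e" for x
          using mult_left_mono[OF c[of x] elim] elim
          by (simp add: abs_mult right_diff_distrib[symmetric])
        from alpha.gibbs_mean_diff_le[OF scaled_admissible[OF V1] scaled_admissible[OF V2]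
            F_admissible this FD]
        show ?case by (simp add: mult.assoc)
      qed
    qed (use integrable_gibbs[OF V1] integrable_gibbs[OF V2] integrable_size_biased in auto)
    also have "\<dots> = size_biased_mean P * (2 * B) * e"
      by (simp add: size_biased_mean_def)
    finally show ?thesis .
  qed
  then show ?thesis
    using B(1) size_biased_mean_nonneg by (intro that[of "size_biased_mean P * (2 * B)"]) auto
qed

lemma near_mod_const_admissible:
  assumes "admissible V1" "admissible V2"
  obtains e where "near_mod_const e V1 V2"
proof -
  obtain B1 B2 where B: "\<And>x. \<bar>V1 x\<bar> \<le> B1" "\<And>x. \<bar>V2 x\<bar> \<le> B2"
    using assms by (metis bounded_range_abs_leE)
  have "\<bar>V1 x - V2 x - 0\<bar> \<le> B1 + B2" for x
    using B(1)[of x] B(2)[of x] by simp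
  then show ?thesis
    by (intro that[of "B1 + B2"]) (unfold near_mod_const_def, blast)
qed

section \<open>Uniqueness and existence of the fixed point\<close>

text \<open>Repeated contraction leaves the two fixed points in place and shows only that they agree
  up to a constant. \<open>T_sup_leE\<close>, applied to the same pair, removes that
  constant.\<close>

lemma solution_unique:
  assumes rate: "rate < 1"
    and "mean_field_solution \<alpha> \<Phi> P V1" "mean_field_solution \<alpha> \<Phi> P V2"
  shows "V1 = V2"
proof
  fix x
  have V: "admissible V1" "admissible V2" and T: "T V1 = V1" "T V2 = V2"
    using assms(2,3) by (auto simp: mean_field_solution_def)
  obtain e where e: "near_mod_const e V1 V2"
    using V by (rule near_mod_const_admissible)
  have near: "near_mod_const (rate ^ n * e) V1 V2" for n
  proof (induction n)
    case (Suc n)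
    from T_osc_le[OF V this] show ?case
      unfolding T by (simp only: power_Suc mult.assoc)
  qed (simp add: e)
  obtain K where "0 \<le> K" and K: "\<And>V1 V2 e \<sigma>. admissible V1 \<Longrightarrow> admissible V2 \<Longrightarrow>
      near_mod_const e V1 V2 \<Longrightarrow> \<bar>T V1 \<sigma> - T V2 \<sigma>\<bar> \<le> K * e"
    by (rule T_sup_leE) blast
  have "\<bar>V1 x - V2 x\<bar> \<le> K * (rate ^ n * e)" for n
    using K[OF V near, of x] unfolding T .
  moreover have "(\<lambda>n. K * (rate ^ n * e)) \<longlonglongrightarrow> K * (0 * e)"
    using rate rate_nonneg by (intro tendsto_intros LIMSEQ_power_zero) (simp add: abs_less_iff)
  ultimately have "\<bar>V1 x - V2 x\<bar> \<le> K * (0 * e)"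
    by (intro LIMSEQ_le_const) auto
  then show "V1 x = V2 x" by simp
qed

lemma solution_exists:
  assumes rate: "rate < 1"
  shows "\<exists>V. mean_field_solution \<alpha> \<Phi> P V"
proof -
  define r where "r = rate"
  have r: "0 \<le> r" "r < 1"
    using rate rate_nonneg by (auto simp: r_def)
  define U where "U n = (T ^^ n) (\<lambda>x. 0)" for n
  have U_Suc: "U (Suc n) = T (U n)" for n
    by (simp add: U_def)
  have U: "admissible (U n)" for n
  proof (induction n)
    case 0
    show ?case by (auto simp: U_def bounded_iff)
  next
    case (Suc n)
    then show ?case unfolding U_Suc by (rule T_admissible)
  qed
  obtain e where e: "near_mod_const e (U 1) (U 0)"
    using U U by (rule near_mod_const_admissible)
  have near: "near_mod_const (r ^ n * e) (U (Suc n)) (U n)" for n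
  proof (induction n)
    case (Suc n)
    from T_osc_le[OF U U this] show ?case
      unfolding U_Suc[symmetric] r_def by (simp only: power_Suc mult.assoc)
  qed (use e in simp)
  obtain K where K: "0 \<le> K" "\<And>V1 V2 e \<sigma>. admissible V1 \<Longrightarrow> admissible V2 \<Longrightarrow>
      near_mod_const e V1 V2 \<Longrightarrow> \<bar>T V1 \<sigma> - T V2 \<sigma>\<bar> \<le> K * e"
    by (rule T_sup_leE) blast
  define b where "b n = r ^ n * (K * e)" for n
  \<comment> \<open>Sup-norm control is available only for images under \<open>T\<close>, so the
    increments start at \<open>U 1\<close> and the index is shifted by one.\<close>
  have step: "\<bar>U (Suc (Suc n)) x - U (Suc n) x\<bar> \<le> b n" for n x
    using K(2)[OF U U near, of n x] unfolding U_Suc[symmetric] by (simp add: b_def ac_simps)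
  have sums_b: "summable b"
    unfolding b_def[abs_def] using r by (intro summable_mult2 summable_geometric) simp
  \<comment> \<open>The limit is written as a telescoping series so that the Weierstrass M-test with
    majorant \<open>b\<close> yields uniform convergence.\<close>
  define V where "V x = U 1 x + (\<Sum>n. U (Suc (Suc n)) x - U (Suc n) x)" for x
  have partial: "U 1 x + (\<Sum>n<N. U (Suc (Suc n)) x - U (Suc n) x) = U (Suc N) x" for x N
    by (induction N) auto
  have unif: "uniform_limit UNIV (\<lambda>N x. \<Sum>n<N. U (Suc (Suc n)) x - U (Suc n) x)
      (\<lambda>x. \<Sum>n. U (Suc (Suc n)) x - U (Suc n) x) sequentially"
    using step sums_b by (intro Weierstrass_m_test) auto
  have lim: "uniform_limit UNIV (\<lambda>N. U (Suc N)) V sequentially"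
    using uniform_limit_add[OF uniform_limit_const unif, of "U 1"]
    unfolding partial V_def[symmetric] .
  then have ptlim: "(\<lambda>N. U (Suc N) x) \<longlonglongrightarrow> V x" for x
    by (rule tendsto_uniform_limitI) simp
  have "V \<in> borel_measurable borel"
    by (rule borel_measurable_LIMSEQ_real[OF ptlim conjunct1[OF U]])
  moreover have "bounded (range V)"
    by (rule uniform_limit_bounded[OF lim always_eventually]) (simp_all add: U)
  ultimately have V: "admissible V" by simp
  \<comment> \<open>Both sides are limits of the same shifted sequence; the second limit uses
    continuity of \<open>T\<close> under uniform convergence.\<close>
  have "T V x = V x" for x
  proof (rule LIMSEQ_unique)
    show "(\<lambda>N. U (Suc (Suc N)) x) \<longlonglongrightarrow> V x"
      using ptlim by (rule LIMSEQ_Suc)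
    show "(\<lambda>N. U (Suc (Suc N)) x) \<longlonglongrightarrow> T V x"
    proof (rule tendstoI)
      fix \<epsilon> :: real assume \<epsilon>: "0 < \<epsilon>"
      \<comment> \<open>Adding 1 to \<open>K\<close> avoids division by zero and makes
        \<open>K * \<eta> < \<epsilon>\<close> strict.\<close>
      define \<eta> where "\<eta> = \<epsilon> / (K + 1)"
      have \<eta>: "0 < \<eta>" "K * \<eta> < \<epsilon>"
        using \<epsilon> K(1) by (auto simp: \<eta>_def field_simps)
      from uniform_limitD[OF lim \<eta>(1)]
      show "\<forall>\<^sub>F N in sequentially. dist (U (Suc (Suc N)) x) (T V x) < \<epsilon>"
      proof eventually_elim
        case (elim N)
        \<comment> \<open>Uniform closeness is closeness modulo constants with constant 0.\<close>
        then have "near_mod_const \<eta> (U (Suc N)) V"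
          unfolding near_mod_const_def dist_real_def
          by (intro exI[of _ 0]) (auto intro: less_imp_le)
        from K(2)[OF U V this, of x] \<eta>(2) show ?case
          unfolding U_Suc[of "Suc N"] dist_real_def by linarith
      qed
    qed
  qed
  with V show ?thesis by (auto simp: mean_field_solution_def)
qed

end

section \<open>From the random variable to its size-biased law\<close>

text \<open>Positivity of \<open>W\<close> makes its expectation strictly positive, so the density
  \<open>w / m\<close> is nonnegative almost everywhere and has total mass 1. The second moment
  makes that expectation finite, and also the size-biased mean, whose integrand under
  \<open>P\<close> is \<open>w\<^sup>2 / m\<close>.\<close>

lemma mean_field_distr:
  fixes \<alpha> :: "'a::polish_space measure"
  assumes alpha: "prob_space \<alpha>" "sets \<alpha> = sets borel"
    and Phi: "\<Phi> \<in> borel_measurable borel" "bounded (range \<Phi>)"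
    and M: "prob_space M" and W [measurable]: "W \<in> borel_measurable M"
    and pos: "\<And>\<omega>. \<omega> \<in> space M \<Longrightarrow> 0 < W \<omega>"
    and P: "P = distr M borel W"
    and sq: "integrable M (\<lambda>\<omega>. (W \<omega>)\<^sup>2)"
  shows "mean_field \<alpha> \<Phi> P"
proof -
  interpret M: prob_space M by (rule M)
  have iW: "integrable M W"
    by (rule M.square_integrable_imp_integrable[OF W sq])
  have sets_P [measurable_cong]: "sets P = sets borel" by (simp add: P)
  define m where "m = (\<integral>x. x \<partial>P)"
  have m_eq: "m = M.expectation W"
    by (simp add: m_def P integral_distr)
  have "M.expectation (\<lambda>x. 0) < M.expectation W"
    using iW pos M.emeasure_space_1 by (intro M.integral_less_AE_space) auto
  then have m: "0 < m" by (simp add: m_eq)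
  have AE_P: "AE w in P. 0 < w"
    unfolding P by (subst AE_distr_iff) (auto simp: pos)
  have iP: "integrable P (\<lambda>w. w)" "integrable P (\<lambda>w. w\<^sup>2)"
    unfolding P using iW sq by (auto simp: integrable_distr_eq)
  have sb: "size_biased P = density P (\<lambda>w. ennreal (w / m))"
    by (simp add: size_biased_def m_def)
  have "emeasure (size_biased P) (space (size_biased P)) = (\<integral>\<^sup>+w. ennreal (w / m) \<partial>P)"
    by (simp add: sb emeasure_density cong: nn_integral_cong)
  also have "\<dots> = ennreal (\<integral>w. w / m \<partial>P)"
    using iP AE_P m by (intro nn_integral_eq_integral) (auto elim!: eventually_mono)
  also have "\<dots> = 1"
    using m by (simp add: m_def[symmetric])
  finally have "prob_space (size_biased P)" by (rule prob_spaceI)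
  moreover have "AE w in size_biased P. 0 \<le> w"
    unfolding sb using AE_P by (subst AE_density) (auto elim!: eventually_mono)
  moreover have "integrable (size_biased P) (\<lambda>w. w)"
  proof -
    have "AE w in P. 0 \<le> w / m"
      using AE_P m by (auto elim!: eventually_mono)
    moreover have "integrable P (\<lambda>w. (w / m) *\<^sub>R w)"
      using integrable_divide[OF iP(2), of m] by (simp add: power2_eq_square)
    ultimately show ?thesis
      unfolding sb by (subst integrable_density) auto
  qed
  moreover have "sets (size_biased P) = sets borel"
    by (simp add: sb sets_P)
  ultimately show ?thesis
    using alpha Phi by (intro mean_field.intro)
qed

theorem theorem4p5:
  fixes \<alpha> :: "'a::polish_space measure"
    and \<Phi> :: "'a \<times> 'a \<Rightarrow> real"
    and M :: "'b measure"
    and W :: "'b \<Rightarrow> real"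
    and P :: "real measure"
  assumes "compact (UNIV :: 'a set)"
    and "prob_space \<alpha>" and "sets \<alpha> = sets borel"
    and "\<Phi> \<in> borel_measurable borel" and "bounded (range \<Phi>)"
    and "prob_space M" and "W \<in> borel_measurable M"
    and "\<And>\<omega>. \<omega> \<in> space M \<Longrightarrow> 0 < W \<omega>"
    and "P = distr M borel W"
    and "integrable M (\<lambda>\<omega>. (W \<omega>)\<^sup>2)"
    and "size_biased_mean P * (1 / 2 * second_order_variation (\<lambda>p. exp (\<Phi> p))) < 1"
  shows "\<exists>!V. mean_field_solution \<alpha> \<Phi> P V"
proof -
  interpret mean_field \<alpha> \<Phi> P
    by (rule mean_field_distr[OF assms(2-10)])
  show ?thesis
    using solution_exists[OF assms(11)] solution_unique[OF assms(11)] by blast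
qed

end
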